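(* Let $(\mathbf b^{\{m\}},\mathbf A^{\{m,\ell\}})_{m,\ell=1}^N$ be a symmetric GARK scheme with all weights $b_i^{\{m\}}$ nonzero. Then its discrete adjoint scheme $(\mathbf b^{\{m\}},\widehat{\mathbf A}^{\{m,\ell\}})$, given by $$\widehat{\mathbf A}^{\{q,m\}}=\mathbf 1^{\{q\}}\mathbf b^{\{m\}\top}-(\mathbf B^{\{q\}})^{-1}(\mathbf A^{\{m,q\}})^{\top}\mathbf B^{\{m\}},\qquad \mathbf B^{\{m\}}=\operatorname{diag}(\mathbf b^{\{m\}}),$$ is also symmetric, and so is the partitioned GARK scheme $(\mathbf b^{\{m\}},\mathbf A^{\{m,\ell\}},\widehat{\mathbf A}^{\{m,\ell\}})$ with $\widehat{\mathbf b}^{\{m\}}=\mathbf b^{\{m\}}$.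
   Context: A GARK scheme with $N$ partitions is given by real coefficients $\mathbf A^{\{q,m\}}=(a^{\{q,m\}}_{i,j})\in\mathbb R^{s^{\{q\}}\times s^{\{m\}}}$, $\mathbf b^{\{m\}}\in\mathbb R^{s^{\{m\}}}$, $q,m=1,\dots,N$; $\mathbf 1^{\{q\}}\in\mathbb R^{s^{\{q\}}}$ is the vector of ones and $\mathcal P^{\{m\}}\in\mathbb R^{s^{\{m\}}\times s^{\{m\}}}$ the permutation matrix reversing the order of the entries of a vector. Symmetric GARK scheme: $\mathbf b^{\{m\}}=\mathcal P^{\{m\}}\mathbf b^{\{m\}}$ and $\mathbf A^{\{\ell,m\}}=\mathbf 1^{\{\ell\}}\mathbf b^{\{m\}\top}-\mathcal P^{\{\ell\}}\mathbf A^{\{\ell,m\}}\mathcal P^{\{m\}}$ for all $\ell,m$. Partitioned GARK scheme $(\mathbf b^{\{m\}},\mathbf A^{\{m,\ell\}},\widehat{\mathbf b}^{\{m\}},\widehat{\mathbf A}^{\{m,\ell\}})$, for Hamiltonians $H=\sum_{m=1}^N(T^{\{m\}}(\mathbf p)+V^{\{m\}}(\mathbf q))$: $$P_i^{\{q\}}=\mathbf p_0+h\sum_{m,j}\widehat a_{i,j}^{\{q,m\}}k_j^{\{m\}},\qquad Q_i^{\{q\}}=\mathbf q_0+h\sum_{m,j}a_{i,j}^{\{q,m\}}\ell_j^{\{m\}},$$ $$\mathbf p_1=\mathbf p_0+h\sum_{q,i}\widehat b_i^{\{q\}}k_i^{\{q\}},\qquad \mathbf q_1=\mathbf q_0+h\sum_{q,i}b_i^{\{q\}}\ell_i^{\{q\}},$$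 with $k_i^{\{m\}}=-V^{\{m\}}_{\mathbf q}(Q_i^{\{m\}})$, $\ell_i^{\{m\}}=T^{\{m\}}_{\mathbf p}(P_i^{\{m\}})$. It is symmetric if its coefficients are invariant under time reversal, i.e. if both $(\mathbf b^{\{m\}},\mathbf A^{\{m,\ell\}})$ and $(\widehat{\mathbf b}^{\{m\}},\widehat{\mathbf A}^{\{m,\ell\}})$ satisfy the symmetry relations above. *)

theory Defs
  imports "HOL.Real" "Jordan_Normal_Form.Gauss_Jordan_Elimination"
begin

text \<open>
  Partitions are numbered \<open>1, \<dots>, N\<close> and partition \<open>q\<close> has \<open>s q\<close> stages, so that the
  matrices have genuinely different formats.  Vectors and matrices of Jordan_Normal_Form
  are indexed from 0: entry \<open>$ i\<close> of a weight vector belongs to stage \<open>i + 1\<close>.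
\<close>

definition ones_vec :: "nat \<Rightarrow> real vec" where
  "ones_vec n = vec n (\<lambda>i. 1)"

definition outer_product :: "real vec \<Rightarrow> real vec \<Rightarrow> real mat" where
  "outer_product x y = mat (dim_vec x) (dim_vec y) (\<lambda>(i, j). x $ i * y $ j)"

definition diag_of_vec :: "real vec \<Rightarrow> real mat" where
  "diag_of_vec v = mat_diag (dim_vec v) (\<lambda>i. v $ i)"

text \<open>The permutation matrix with \<open>(P v) $ i = v $ (n - 1 - i)\<close>.\<close>

definition reversal_mat :: "nat \<Rightarrow> real mat" where
  "reversal_mat n = mat n n (\<lambda>(i, j). if i + j + 1 = n then 1 else 0)"

definition gark_scheme ::
  "nat \<Rightarrow> (nat \<Rightarrow> nat) \<Rightarrow> (nat \<Rightarrow> real vec) \<Rightarrow> (nat \<Rightarrow> nat \<Rightarrow> real mat) \<Rightarrow> bool" where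
  "gark_scheme N s b A \<longleftrightarrow>
     (\<forall>m\<in>{1..N}. b m \<in> carrier_vec (s m)) \<and>
     (\<forall>q\<in>{1..N}. \<forall>m\<in>{1..N}. A q m \<in> carrier_mat (s q) (s m))"

definition symmetric_gark ::
  "nat \<Rightarrow> (nat \<Rightarrow> nat) \<Rightarrow> (nat \<Rightarrow> real vec) \<Rightarrow> (nat \<Rightarrow> nat \<Rightarrow> real mat) \<Rightarrow> bool" where
  "symmetric_gark N s b A \<longleftrightarrow>
     gark_scheme N s b A \<and>
     (\<forall>m\<in>{1..N}. b m = reversal_mat (s m) *\<^sub>v b m) \<and>
     (\<forall>l\<in>{1..N}. \<forall>m\<in>{1..N}.
        A l m = outer_product (ones_vec (s l)) (b m)
                - reversal_mat (s l) * A l m * reversal_mat (s m))"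

text \<open>
  A partitioned GARK scheme \<open>(b, A, b', A')\<close> consists of two sets of GARK coefficients with
  common stage numbers: \<open>(b, A)\<close> is applied to the positions and \<open>(b', A')\<close> to the momenta.
  It is symmetric if both coefficient sets are invariant under time reversal.
\<close>

definition symmetric_partitioned_gark ::
  "nat \<Rightarrow> (nat \<Rightarrow> nat) \<Rightarrow> (nat \<Rightarrow> real vec) \<Rightarrow> (nat \<Rightarrow> nat \<Rightarrow> real mat) \<Rightarrow>
   (nat \<Rightarrow> real vec) \<Rightarrow> (nat \<Rightarrow> nat \<Rightarrow> real mat) \<Rightarrow> bool" where
  "symmetric_partitioned_gark N s b A b' A' \<longleftrightarrow>
     symmetric_gark N s b A \<and> symmetric_gark N s b' A'"

text \<open>
  \<^const>\<open>mat_inverse\<close> returns \<open>None\<close> on singular matrices, so this is meaningful only if all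
  entries of \<open>b q\<close> are nonzero.
\<close>

definition adjoint_coeffs ::
  "(nat \<Rightarrow> nat) \<Rightarrow> (nat \<Rightarrow> real vec) \<Rightarrow> (nat \<Rightarrow> nat \<Rightarrow> real mat) \<Rightarrow> nat \<Rightarrow> nat \<Rightarrow> real mat" where
  "adjoint_coeffs s b A q m =
     outer_product (ones_vec (s q)) (b m)
     - the (mat_inverse (diag_of_vec (b q))) * transpose_mat (A m q) * diag_of_vec (b m)"

end

theory Submission
  imports Defs
begin

text \<open>
  Entrywise, symmetry says that \<open>b\<close> is a palindrome and that each entry of \<open>A l m\<close> and its point
  reflection add up to the weight \<open>b m $ j\<close> of its column.  The adjoint coefficient
  \<open>b m $ j - A m q $$ (j, i) * b m $ j / b q $ i\<close> and its reflection therefore add up to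
  \<open>2 * b m $ j - b q $ i * b m $ j / b q $ i = b m $ j\<close>.
\<close>

lemma reversal_mat_dim [simp]:
  "dim_row (reversal_mat n) = n" "dim_col (reversal_mat n) = n"
  by (simp_all add: reversal_mat_def)

text \<open>Row \<open>i\<close> of the reversal matrix has its single 1 in column
  \<open>n - Suc i\<close>. The three product formulas that follow all reduce to this sum.\<close>

lemma sum_reversal_row:
  fixes f :: "nat \<Rightarrow> real"
  assumes "i < n"
  shows "(\<Sum>k = 0..<n. (if i + k + 1 = n then 1 else 0) * f k) = f (n - Suc i)"
proof -
  have "(\<Sum>k = 0..<n. (if i + k + 1 = n then 1 else 0) * f k) =
        (\<Sum>k = 0..<n. if k = n - Suc i then f k else 0)"
    using assms by (intro sum.cong) auto
  also have "\<dots> = f (n - Suc i)"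
    using assms by simp
  finally show ?thesis .
qed

lemma reversal_mat_mult_vec_index:
  assumes "v \<in> carrier_vec n" "i < n"
  shows "(reversal_mat n *\<^sub>v v) $ i = v $ (n - Suc i)"
proof -
  have "(reversal_mat n *\<^sub>v v) $ i = (\<Sum>k = 0..<n. (if i + k + 1 = n then 1 else 0) * v $ k)"
    using assms by (auto simp: scalar_prod_def reversal_mat_def intro!: sum.cong)
  then show ?thesis
    using sum_reversal_row[OF assms(2)] by (rule trans)
qed

lemma reversal_mat_mult_index:
  assumes "M \<in> carrier_mat n k" "i < n" "j < k"
  shows "(reversal_mat n * M) $$ (i, j) = M $$ (n - Suc i, j)"
proof -
  have "(reversal_mat n * M) $$ (i, j) =
        (\<Sum>r = 0..<n. (if i + r + 1 = n then 1 else 0) * M $$ (r, j))"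
    using assms by (auto simp: scalar_prod_def reversal_mat_def intro!: sum.cong)
  then show ?thesis
    using sum_reversal_row[OF assms(2)] by (rule trans)
qed

lemma mult_reversal_mat_index:
  assumes "M \<in> carrier_mat k n" "i < k" "j < n"
  shows "(M * reversal_mat n) $$ (i, j) = M $$ (i, n - Suc j)"
proof -
  \<comment> \<open>The reversal matrix is its own transpose, so its column \<open>j\<close> may be
    written as row \<open>j\<close>, with \<open>j\<close> first in the condition as
    \<open>sum_reversal_row\<close> expects.\<close>
  have "(M * reversal_mat n) $$ (i, j) =
        (\<Sum>r = 0..<n. (if j + r + 1 = n then 1 else 0) * M $$ (i, r))"
    using assms by (auto simp: scalar_prod_def reversal_mat_def intro!: sum.cong)
  then show ?thesis
    using sum_reversal_row[OF assms(3)] by (rule trans)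
qed

lemma reversal_conjugate_index:
  assumes "M \<in> carrier_mat n k" "i < n" "j < k"
  shows "(reversal_mat n * M * reversal_mat k) $$ (i, j) = M $$ (n - Suc i, k - Suc j)"
proof -
  have "reversal_mat n \<in> carrier_mat n n"
    by (simp add: reversal_mat_def)
  then have "reversal_mat n * M \<in> carrier_mat n k"
    using assms(1) by (rule mult_carrier_mat)
  then have "(reversal_mat n * M * reversal_mat k) $$ (i, j) = (reversal_mat n * M) $$ (i, k - Suc j)"
    using assms(2,3) by (rule mult_reversal_mat_index)
  also have "\<dots> = M $$ (n - Suc i, k - Suc j)"
    using assms by (intro reversal_mat_mult_index) auto
  finally show ?thesis .
qed

lemma vec_reversal_invariant_iff:
  assumes "v \<in> carrier_vec n"
  shows "v = reversal_mat n *\<^sub>v v \<longleftrightarrow> (\<forall>i<n. v $ i = v $ (n - Suc i))"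
proof -
  have "v = reversal_mat n *\<^sub>v v \<longleftrightarrow> (\<forall>i<n. v $ i = (reversal_mat n *\<^sub>v v) $ i)"
    using assms by (simp only: vec_eq_iff dim_mult_mat_vec reversal_mat_dim carrier_vecD) blast
  also have "\<dots> \<longleftrightarrow> (\<forall>i<n. v $ i = v $ (n - Suc i))"
    by (intro all_cong1 imp_cong refl) (simp only: reversal_mat_mult_vec_index[OF assms])
  finally show ?thesis .
qed

text \<open>An equivalence because both directions serve: from left to right for the given
  \<open>A\<close>, from right to left for the adjoint coefficients.\<close>

lemma mat_symmetry_relation_iff:
  assumes "M \<in> carrier_mat n k" "v \<in> carrier_vec k"
  shows "M = outer_product (ones_vec n) v - reversal_mat n * M * reversal_mat k \<longleftrightarrow>
         (\<forall>i<n. \<forall>j<k. M $$ (i, j) = v $ j - M $$ (n - Suc i, k - Suc j))"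
proof -
  let ?R = "outer_product (ones_vec n) v - reversal_mat n * M * reversal_mat k"
  \<comment> \<open>A difference takes its format from the subtrahend, whose format is fixed by the
    two outer reversal matrices.\<close>
  have R: "dim_row ?R = n" "dim_col ?R = k"
    by simp_all
  have index: "?R $$ (i, j) = v $ j - M $$ (n - Suc i, k - Suc j)" if "i < n" "j < k" for i j
    using that assms reversal_conjugate_index[OF assms(1) that]
    by (simp add: outer_product_def ones_vec_def)
  have "M = ?R \<longleftrightarrow> (\<forall>i<n. \<forall>j<k. M $$ (i, j) = ?R $$ (i, j))"
    using assms unfolding mat_eq_iff[of M] R by (simp only: carrier_matD simp_thms) blast
  also have "\<dots> \<longleftrightarrow> (\<forall>i<n. \<forall>j<k. M $$ (i, j) = v $ j - M $$ (n - Suc i, k - Suc j))"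
    by (intro all_cong1 imp_cong refl) (simp only: index)
  finally show ?thesis .
qed

text \<open>Gauss-Jordan elimination is not traced here. Invertibility in the matrix ring rules out
  \<open>None\<close>, and uniqueness of the inverse then identifies the result.\<close>

lemma mat_inverse_diag_of_vec:
  assumes "\<And>i. i < dim_vec v \<Longrightarrow> v $ i \<noteq> 0"
  shows "mat_inverse (diag_of_vec v) = Some (mat_diag (dim_vec v) (\<lambda>i. inverse (v $ i)))"
proof -
  let ?n = "dim_vec v"
  let ?D = "diag_of_vec v" and ?E = "mat_diag ?n (\<lambda>i. inverse (v $ i))"
  have D: "?D \<in> carrier_mat ?n ?n"
    by (simp add: diag_of_vec_def)
  have E: "?E \<in> carrier_mat ?n ?n"
    by simp
  have DE: "?D * ?E = 1\<^sub>m ?n" and ED: "?E * ?D = 1\<^sub>m ?n"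
    using assms unfolding diag_of_vec_def mat_diag_diag by (auto simp: mat_diag_def intro!: eq_matI)
  have "?D \<in> Units (ring_mat TYPE(real) ?n ())"
    unfolding Units_def ring_mat_simps using D E DE ED by blast
  then have "mat_inverse ?D \<noteq> None"
    using mat_inverse(1)[OF D, of "()"] by blast
  then obtain F where F: "mat_inverse ?D = Some F"
    by blast
  from mat_inverse(2)[OF D F] have FD: "F * ?D = 1\<^sub>m ?n" and Fc: "F \<in> carrier_mat ?n ?n"
    by auto
  \<comment> \<open>A left inverse \<open>F\<close> and a right inverse \<open>?E\<close> of the
    same matrix coincide.\<close>
  have "F = F * (?D * ?E)"
    unfolding DE by (rule right_mult_one_mat[OF Fc, symmetric])
  also have "\<dots> = F * ?D * ?E"
    by (rule assoc_mult_mat[OF Fc D E, symmetric])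
  also have "\<dots> = ?E"
    unfolding FD by (rule left_mult_one_mat[OF E])
  finally show ?thesis
    using F by simp
qed

text \<open>Even the format depends on nonzero weights: without them \<open>the\<close> could meet
  \<open>None\<close>, about whose value nothing is known.\<close>

lemma adjoint_coeffs_carrier:
  assumes "b q \<in> carrier_vec (s q)" "b m \<in> carrier_vec (s m)"
    and "\<And>i. i < s q \<Longrightarrow> b q $ i \<noteq> 0"
  shows "adjoint_coeffs s b A q m \<in> carrier_mat (s q) (s m)"
proof -
  have "mat_inverse (diag_of_vec (b q)) = Some (mat_diag (s q) (\<lambda>i. inverse (b q $ i)))"
    using mat_inverse_diag_of_vec[of "b q"] assms by auto
  then show ?thesis
    using assms by (auto simp: adjoint_coeffs_def diag_of_vec_def mat_diag_def)
qed

text \<open>The left diagonal factor divides row \<open>i\<close> of the transpose by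
  \<open>b q $ i\<close>, and the right one multiplies column \<open>j\<close> by
  \<open>b m $ j\<close>.\<close>

lemma adjoint_coeffs_index:
  assumes "b q \<in> carrier_vec (s q)" "b m \<in> carrier_vec (s m)" "A m q \<in> carrier_mat (s m) (s q)"
    and "\<And>i. i < s q \<Longrightarrow> b q $ i \<noteq> 0"
    and "i < s q" "j < s m"
  shows "adjoint_coeffs s b A q m $$ (i, j) = b m $ j - A m q $$ (j, i) * b m $ j / b q $ i"
proof -
  define L where "L = mat_diag (s q) (\<lambda>i. inverse (b q $ i)) * transpose_mat (A m q)"
  define R where "R = mat_diag (s m) (\<lambda>j. b m $ j)"
  have dims: "dim_vec (b q) = s q" "dim_vec (b m) = s m"
    using assms by auto
  have inv: "mat_inverse (diag_of_vec (b q)) = Some (mat_diag (s q) (\<lambda>i. inverse (b q $ i)))"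
    using mat_inverse_diag_of_vec[of "b q"] assms(4) dims by simp
  have adj: "adjoint_coeffs s b A q m = outer_product (ones_vec (s q)) (b m) - L * R"
    by (simp only: adjoint_coeffs_def inv option.sel L_def R_def diag_of_vec_def[of "b m"] dims)
  have T: "transpose_mat (A m q) \<in> carrier_mat (s q) (s m)"
    using assms by simp
  have L: "L \<in> carrier_mat (s q) (s m)"
    unfolding L_def using T by (intro mult_carrier_mat[of _ _ "s q"]) auto
  have R: "R \<in> carrier_mat (s m) (s m)"
    by (simp add: R_def)
  have L_index: "L $$ (i, j) = inverse (b q $ i) * A m q $$ (j, i)"
    using assms unfolding L_def by (subst mat_diag_mult_left[OF T]) simp
  have "(L * R) $$ (i, j) = A m q $$ (j, i) * b m $ j / b q $ i"
    using assms unfolding R_def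
    by (subst mat_diag_mult_right[OF L]) (simp add: L_index divide_inverse)
  \<comment> \<open>Removing \<open>index_mult_mat(1)\<close> keeps the entry of
    \<open>L * R\<close> from being unfolded into a scalar product, so that it matches the previous
    fact.\<close>
  moreover have "adjoint_coeffs s b A q m $$ (i, j) = b m $ j - (L * R) $$ (i, j)"
    unfolding adj using assms L R dims
    by (subst index_minus_mat(1))
      (simp_all add: outer_product_def ones_vec_def del: index_mult_mat(1))
  ultimately show ?thesis
    by simp
qed

lemma symmetric_gark_adjoint:
  assumes sym: "symmetric_gark N s b A"
    and nz: "\<And>m i. m \<in> {1..N} \<Longrightarrow> i < s m \<Longrightarrow> b m $ i \<noteq> 0"
  shows "symmetric_gark N s b (adjoint_coeffs s b A)"
proof -
  have bc: "b m \<in> carrier_vec (s m)" if "m \<in> {1..N}" for m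
    using sym that by (auto simp: symmetric_gark_def gark_scheme_def)
  have Ac: "A q m \<in> carrier_mat (s q) (s m)" if "q \<in> {1..N}" "m \<in> {1..N}" for q m
    using sym that by (auto simp: symmetric_gark_def gark_scheme_def)
  have b_inv: "b m = reversal_mat (s m) *\<^sub>v b m" if "m \<in> {1..N}" for m
    using sym that unfolding symmetric_gark_def by blast
  \<comment> \<open>This fact and \<open>A_rev\<close> have the reflected entry on the left, so that
    as rewrite rules they remove reflected indices.\<close>
  have b_rev: "b m $ (s m - Suc i) = b m $ i" if "m \<in> {1..N}" "i < s m" for m i
    using b_inv[OF that(1)] vec_reversal_invariant_iff[OF bc[OF that(1)]] that(2) by metis
  have A_rev: "A l m $$ (s l - Suc i, s m - Suc j) = b m $ j - A l m $$ (i, j)"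
    if lm: "l \<in> {1..N}" "m \<in> {1..N}" and ij: "i < s l" "j < s m" for l m i j
  proof -
    have "A l m = outer_product (ones_vec (s l)) (b m)
                  - reversal_mat (s l) * A l m * reversal_mat (s m)"
      using sym lm unfolding symmetric_gark_def by blast
    then have "A l m $$ (i, j) = b m $ j - A l m $$ (s l - Suc i, s m - Suc j)"
      using mat_symmetry_relation_iff[OF Ac[OF lm] bc[OF lm(2)]] ij by blast
    then show ?thesis by simp
  qed
  have Bc: "adjoint_coeffs s b A q m \<in> carrier_mat (s q) (s m)"
    if "q \<in> {1..N}" "m \<in> {1..N}" for q m
    using that by (intro adjoint_coeffs_carrier bc nz)
  have B_index: "adjoint_coeffs s b A q m $$ (i, j) = b m $ j - A m q $$ (j, i) * b m $ j / b q $ i"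
    if "q \<in> {1..N}" "m \<in> {1..N}" "i < s q" "j < s m" for q m i j
    using that by (intro adjoint_coeffs_index bc Ac nz)
  have "adjoint_coeffs s b A l m = outer_product (ones_vec (s l)) (b m)
          - reversal_mat (s l) * adjoint_coeffs s b A l m * reversal_mat (s m)"
    if lm: "l \<in> {1..N}" "m \<in> {1..N}" for l m
  proof -
    have "adjoint_coeffs s b A l m $$ (i, j) =
          b m $ j - adjoint_coeffs s b A l m $$ (s l - Suc i, s m - Suc j)"
      if ij: "i < s l" "j < s m" for i j
      \<comment> \<open>\<open>B_index\<close> applies at both positions. The transposed block
        \<open>A m l\<close> has column weight \<open>b l $ i\<close>, which is also the divisor;
        hence the reflected adjoint entry is
        \<open>b m $ j - (b l $ i - A m l $$ (j, i)) * b m $ j / b l $ i\<close>, that is,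
        \<open>A m l $$ (j, i) * b m $ j / b l $ i\<close>.\<close>
      using lm ij nz[OF lm(1) ij(1)] by (simp add: B_index b_rev A_rev field_simps)
    then show ?thesis
      using mat_symmetry_relation_iff[OF Bc[OF lm] bc[OF lm(2)]] by blast
  qed
  then show ?thesis
    using bc Bc b_inv unfolding symmetric_gark_def gark_scheme_def by blast
qed

theorem lemma4p5:
  fixes N :: nat and s :: "nat \<Rightarrow> nat"
    and b :: "nat \<Rightarrow> real vec" and A :: "nat \<Rightarrow> nat \<Rightarrow> real mat"
  assumes "symmetric_gark N s b A"
    and "\<And>m i. m \<in> {1..N} \<Longrightarrow> i < s m \<Longrightarrow> b m $ i \<noteq> 0"
  shows "symmetric_gark N s b (adjoint_coeffs s b A) \<and>
         symmetric_partitioned_gark N s b A b (adjoint_coeffs s b A)"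
  using assms(1) symmetric_gark_adjoint[OF assms]
  by (simp add: symmetric_partitioned_gark_def)

end
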